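(* Assume $\mathbb F$ is algebraically closed with $\operatorname{char}\mathbb F=0$, and let $d\in\mathbb N$. If $V$ is a $(d+1)$-dimensional irreducible $\Re$-module, then there exist $a,b,c\in\mathbb F$ such that $R_d(a,b,c)$ is isomorphic to $V$.
   Context: The Racah algebra $\Re$ is the unital associative $\mathbb F$-algebra with generators $A,B,C,D$ and relations $[A,B]=[B,C]=[C,A]=2D$ together with the requirement that each of $\alpha:=[A,D]+AC-BA$, $\beta:=[B,D]+BA-CB$, $\gamma:=[C,D]+CB-AC$ is central in $\Re$; $\delta:=A+B+C$. For $a,b,c\in\mathbb F$ and $d\in\mathbb N$ set $\theta_i=(a+\tfrac d2-i)(a+\tfrac d2-i+1)$, $\theta_i^*=(b+\tfrac d2-i)(b+\tfrac d2-i+1)$, $\varphi_i=i(i-d-1)(a+b+c+\tfrac d2-i+2)(a+b-c+\tfrac d2-i+1)$. $R_d(a,b,c)$ denotes the $(d+1)$-dimensional $\Re$-module with a basis $v_0,\dots,v_d$ such that $Av_i=\theta_iv_i+v_{i+1}$ ($v_{d+1}=0$), $Bv_i=\theta_i^*v_i+\varphi_iv_{i-1}$ ($v_{-1}=0$), and $\alpha,\beta,\delta$ act as the scalars $(c-b)(c+b+1)(a-\tfrac d2)(a+\tfrac d2+1)$, $(a-c)(a+c+1)(b-\tfrac d2)(b+\tfrac d2+1)$, $\tfrac d2(\tfrac d2+1)+a(a+1)+b(b+1)+c(c+1)$ respectively (exists, unique up to isomorphism). *)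

theory Defs
  imports "HOL-Computational_Algebra.Polynomial"
begin

text \<open>A module for the Racah algebra on an F-vector space (type 'v, scalar multiplication sc):
  four F-linear operators A B C D (the actions of the generators) such that
  [A,B] = [B,C] = [C,A] = 2D and the actions of alpha, beta, gamma commute with the
  actions of all generators (hence with the action of every element of the algebra).\<close>

definition op_comm :: "('v::ab_group_add \<Rightarrow> 'v) \<Rightarrow> ('v \<Rightarrow> 'v) \<Rightarrow> 'v \<Rightarrow> 'v" where
  "op_comm X Y = (\<lambda>v. X (Y v) - Y (X v))"

definition racah_alpha :: "('v::ab_group_add \<Rightarrow> 'v) \<Rightarrow> ('v \<Rightarrow> 'v) \<Rightarrow> ('v \<Rightarrow> 'v) \<Rightarrow> ('v \<Rightarrow> 'v) \<Rightarrow> 'v \<Rightarrow> 'v" where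
  "racah_alpha A B C D = (\<lambda>v. op_comm A D v + A (C v) - B (A v))"

definition racah_beta :: "('v::ab_group_add \<Rightarrow> 'v) \<Rightarrow> ('v \<Rightarrow> 'v) \<Rightarrow> ('v \<Rightarrow> 'v) \<Rightarrow> ('v \<Rightarrow> 'v) \<Rightarrow> 'v \<Rightarrow> 'v" where
  "racah_beta A B C D = (\<lambda>v. op_comm B D v + B (A v) - C (B v))"

definition racah_gamma :: "('v::ab_group_add \<Rightarrow> 'v) \<Rightarrow> ('v \<Rightarrow> 'v) \<Rightarrow> ('v \<Rightarrow> 'v) \<Rightarrow> ('v \<Rightarrow> 'v) \<Rightarrow> 'v \<Rightarrow> 'v" where
  "racah_gamma A B C D = (\<lambda>v. op_comm C D v + C (B v) - A (C v))"

definition commutes_with :: "('v \<Rightarrow> 'v) \<Rightarrow> ('v \<Rightarrow> 'v) \<Rightarrow> bool" where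
  "commutes_with Z X \<longleftrightarrow> (\<forall>v. Z (X v) = X (Z v))"

definition racah_module ::
  "('a::field \<Rightarrow> 'v::ab_group_add \<Rightarrow> 'v) \<Rightarrow> ('v \<Rightarrow> 'v) \<Rightarrow> ('v \<Rightarrow> 'v) \<Rightarrow> ('v \<Rightarrow> 'v) \<Rightarrow> ('v \<Rightarrow> 'v) \<Rightarrow> bool" where
  "racah_module sc A B C D \<longleftrightarrow>
     vector_space sc \<and>
     Vector_Spaces.linear sc sc A \<and> Vector_Spaces.linear sc sc B \<and> Vector_Spaces.linear sc sc C \<and> Vector_Spaces.linear sc sc D \<and>
     (\<forall>v. op_comm A B v = sc 2 (D v)) \<and>
     (\<forall>v. op_comm B C v = sc 2 (D v)) \<and>
     (\<forall>v. op_comm C A v = sc 2 (D v)) \<and>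
     (\<forall>Z \<in> {racah_alpha A B C D, racah_beta A B C D, racah_gamma A B C D}.
        \<forall>X \<in> {A, B, C, D}. commutes_with Z X)"

definition racah_irreducible ::
  "('a::field \<Rightarrow> 'v::ab_group_add \<Rightarrow> 'v) \<Rightarrow> ('v \<Rightarrow> 'v) \<Rightarrow> ('v \<Rightarrow> 'v) \<Rightarrow> ('v \<Rightarrow> 'v) \<Rightarrow> ('v \<Rightarrow> 'v) \<Rightarrow> bool" where
  "racah_irreducible sc A B C D \<longleftrightarrow>
     racah_module sc A B C D \<and> (UNIV :: 'v set) \<noteq> {0} \<and>
     (\<forall>W. module.subspace sc W \<and> (\<forall>X \<in> {A, B, C, D}. X ` W \<subseteq> W) \<longrightarrow> W = {0} \<or> W = UNIV)"

text \<open>The module R_d(a,b,c): matrix entries (row i, column j) with respect to the basis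
  v_0..v_d, i.e. X v_j = sum_i M i j v_i.  A and B as in the paper, C = delta - A - B
  (delta acts as the given scalar), D = [A,B]/2.\<close>

definition rd_theta :: "'a::field_char_0 \<Rightarrow> nat \<Rightarrow> nat \<Rightarrow> 'a" where
  "rd_theta a d i = (a + of_nat d / 2 - of_nat i) * (a + of_nat d / 2 - of_nat i + 1)"

definition rd_phi :: "'a::field_char_0 \<Rightarrow> 'a \<Rightarrow> 'a \<Rightarrow> nat \<Rightarrow> nat \<Rightarrow> 'a" where
  "rd_phi a b c d i = of_nat i * (of_nat i - of_nat d - 1) * (a + b + c + of_nat d / 2 - of_nat i + 2)
                        * (a + b - c + of_nat d / 2 - of_nat i + 1)"

definition rd_delta :: "'a::field_char_0 \<Rightarrow> 'a \<Rightarrow> 'a \<Rightarrow> nat \<Rightarrow> 'a" where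
  "rd_delta a b c d = of_nat d / 2 * (of_nat d / 2 + 1) + a * (a + 1) + b * (b + 1) + c * (c + 1)"

definition RdA :: "'a::field_char_0 \<Rightarrow> 'a \<Rightarrow> 'a \<Rightarrow> nat \<Rightarrow> nat \<Rightarrow> nat \<Rightarrow> 'a" where
  "RdA a b c d i j = (if i = j then rd_theta a d j else if i = Suc j then 1 else 0)"

definition RdB :: "'a::field_char_0 \<Rightarrow> 'a \<Rightarrow> 'a \<Rightarrow> nat \<Rightarrow> nat \<Rightarrow> nat \<Rightarrow> 'a" where
  "RdB a b c d i j = (if i = j then rd_theta b d j else if Suc i = j then rd_phi a b c d j else 0)"

definition RdC :: "'a::field_char_0 \<Rightarrow> 'a \<Rightarrow> 'a \<Rightarrow> nat \<Rightarrow> nat \<Rightarrow> nat \<Rightarrow> 'a" where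
  "RdC a b c d i j = (if i = j then rd_delta a b c d else 0) - RdA a b c d i j - RdB a b c d i j"

definition RdD :: "'a::field_char_0 \<Rightarrow> 'a \<Rightarrow> 'a \<Rightarrow> nat \<Rightarrow> nat \<Rightarrow> nat \<Rightarrow> 'a" where
  "RdD a b c d i j = (\<Sum>k\<le>d. RdA a b c d i k * RdB a b c d k j - RdB a b c d i k * RdA a b c d k j) / 2"

text \<open>An isomorphism R_d(a,b,c) -> V is the same as a basis w_0..w_d of V (the images of
  v_0..v_d) on which the generators act by the matrices of R_d(a,b,c).\<close>

definition acts_by :: "('a::field \<Rightarrow> 'v::ab_group_add \<Rightarrow> 'v) \<Rightarrow> nat \<Rightarrow> (nat \<Rightarrow> 'v) \<Rightarrow> ('v \<Rightarrow> 'v) \<Rightarrow> (nat \<Rightarrow> nat \<Rightarrow> 'a) \<Rightarrow> bool" where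
  "acts_by sc d w X M \<longleftrightarrow> (\<forall>j\<le>d. X (w j) = (\<Sum>i\<le>d. sc (M i j) (w i)))"

definition Rd_iso ::
  "('a::field_char_0 \<Rightarrow> 'v::ab_group_add \<Rightarrow> 'v) \<Rightarrow> ('v \<Rightarrow> 'v) \<Rightarrow> ('v \<Rightarrow> 'v) \<Rightarrow> ('v \<Rightarrow> 'v) \<Rightarrow> ('v \<Rightarrow> 'v)
     \<Rightarrow> nat \<Rightarrow> 'a \<Rightarrow> 'a \<Rightarrow> 'a \<Rightarrow> bool" where
  "Rd_iso sc A B C D d a b c \<longleftrightarrow>
     (\<exists>w :: nat \<Rightarrow> 'v.
        (\<forall>x :: nat \<Rightarrow> 'a. (\<Sum>i\<le>d. sc (x i) (w i)) = 0 \<longrightarrow> (\<forall>i\<le>d. x i = 0)) \<and>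
        (\<forall>v. \<exists>x :: nat \<Rightarrow> 'a. v = (\<Sum>i\<le>d. sc (x i) (w i))) \<and>
        acts_by sc d w A (RdA a b c d) \<and> acts_by sc d w B (RdB a b c d) \<and>
        acts_by sc d w C (RdC a b c d) \<and> acts_by sc d w D (RdD a b c d))"

end

theory Submission
  imports Defs
begin

text \<open>
  By Schur's lemma $\<alpha>$, $\<beta>$, $\<delta>$ act as scalars. Write $\<theta>(x) = x(x+1)$ and let
  $(X, Y)$ be one of the pairs $(A, B)$, $(B, A)$, $(C, A)$; the Racah relations give
  $[X,[X,Y]] = 2(X^2 + XY + YX) - 2\<delta>X + 2\<kappa>$ and the same with $X$ and $Y$ exchanged.
  If $u$ is an eigenvector of $X$ for $\<theta>(x)$ and $\<theta>(x+1)$ is not an eigenvalue, the first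
  relation forces $XYu \<in> \<theta>(x-1)Yu + F u$, the second then makes $X$ triangular on
  $u, Yu, Y^2u, \<dots>$ with diagonal $\<theta>(x-i)$, and by irreducibility the first $d+1$ of these
  vectors form a basis. So the traces of $A, B, C$ and of their squares are known in terms of
  parameters $a, b, c$; taking traces of the relations determines $\<alpha>$, $\<beta>$, $\<delta>$.
  Finally, for the eigenvector $u$ of $B$, the vectors $v_i = \<Prod>_{j<i} (A - \<theta>_j) u$ form the
  basis that identifies the module with $R_d(a,b,c)$.
\<close>

section \<open>Traces and flags\<close>

locale vector_space_dim = vector_space scale
  for scale :: "'a::field \<Rightarrow> 'v::ab_group_add \<Rightarrow> 'v" (infixr \<open>*s\<close> 75) +
  fixes d :: nat
  assumes dim_UNIV_eq: "dim (UNIV :: 'v set) = Suc d"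
begin

abbreviation endo :: "('v \<Rightarrow> 'v) \<Rightarrow> bool" where
  "endo \<equiv> Vector_Spaces.linear scale scale"

lemma endo_simps:
  assumes "endo X"
  shows "X 0 = 0" "X (u + v) = X u + X v" "X (u - v) = X u - X v" "X (- u) = - X u"
    "X (r *s v) = r *s X v" "X (sum f S) = (\<Sum>i\<in>S. X (f i))"
proof -
  interpret module_hom scale scale X using assms unfolding linear_iff_module_hom .
  show "X 0 = 0" "X (u + v) = X u + X v" "X (u - v) = X u - X v" "X (- u) = - X u"
    "X (r *s v) = r *s X v" "X (sum f S) = (\<Sum>i\<in>S. X (f i))"
    by (rule zero add diff neg scale sum)+
qed

lemma endo_span_subset:
  assumes "endo X" "\<And>v. v \<in> S \<Longrightarrow> X v \<in> span T" "v \<in> span S"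
  shows "X v \<in> span T"
  using assms(3)
proof (induction rule: span_induct_alt)
  case (step c x y)
  then have "c *s X x + X y \<in> span T" using assms(2) by (simp add: span_add span_scale)
  then show ?case by (simp add: endo_simps[OF assms(1)])
qed (simp add: endo_simps(1)[OF assms(1)] span_zero)

lemma endo_compose: "endo X \<Longrightarrow> endo Y \<Longrightarrow> endo (\<lambda>v. X (Y v))"
  using Vector_Spaces.linear_compose[of scale scale Y scale X] by (simp add: o_def)

lemma endoI:
  assumes "\<And>u v. X (u + v) = X u + X v" "\<And>r v. X (r *s v) = r *s X v"
  shows "endo X"
  unfolding linear_iff_module_hom module_hom_iff using assms module_axioms by blast

section \<open>Ordered bases indexed by \<open>0..d\<close>, and coordinates\<close>

definition frame :: "(nat \<Rightarrow> 'v) \<Rightarrow> bool" where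
  "frame w \<longleftrightarrow> span (w ` {..d}) = UNIV"

text \<open>A spanning family of \<open>d + 1\<close> vectors in dimension \<open>d + 1\<close>
  leaves no room for a repetition or a dependence. This is why \<open>frame\<close> asks only for
  spanning.\<close>

lemma frame_basis:
  assumes "frame w"
  shows "inj_on w {..d}" "independent (w ` {..d})"
proof -
  obtain Bs where Bs: "independent Bs" "UNIV \<subseteq> span Bs" "card Bs = dim (UNIV :: 'v set)"
    using basis_exists[of UNIV] by blast
  \<comment> \<open>An infinite set has \<open>card\<close> equal to 0, which is not
    \<open>Suc d\<close>.\<close>
  have "finite Bs" using Bs(3) dim_UNIV_eq by (metis card.infinite nat.distinct(1))
  then interpret finite_dimensional_vector_space scale Bs
    by unfold_locales (use Bs in auto)
  have "Suc d \<le> card (w ` {..d})"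
    using dim_le_card[of UNIV "w ` {..d}"] assms dim_UNIV_eq by (simp add: frame_def)
  moreover have "card (w ` {..d}) \<le> card {..d}" by (rule card_image_le) simp
  ultimately have c: "card (w ` {..d}) = Suc d" by simp
  then show "inj_on w {..d}" by (intro eq_card_imp_inj_on) auto
  show "independent (w ` {..d})"
    using card_le_dim_spanning[of "w ` {..d}" UNIV] assms c dim_UNIV_eq by (simp add: frame_def)
qed

lemma frame_exists: "\<exists>w. frame w"
proof -
  obtain Bs where Bs: "independent Bs" "UNIV \<subseteq> span Bs" "card Bs = dim (UNIV :: 'v set)"
    using basis_exists[of UNIV] by blast
  have "finite Bs" using Bs(3) dim_UNIV_eq by (metis card.infinite nat.distinct(1))
  then obtain w where "bij_betw w {0..<card Bs} Bs"
    using ex_bij_betw_nat_finite by blast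
  then have "w ` {..d} = Bs"
    using Bs(3) dim_UNIV_eq
    by (simp add: bij_betw_def atLeast0LessThan lessThan_Suc_atMost)
  then show ?thesis using Bs(2) unfolding frame_def by (intro exI[of _ w]) auto
qed

definition coord :: "(nat \<Rightarrow> 'v) \<Rightarrow> nat \<Rightarrow> 'v \<Rightarrow> 'a" where
  "coord w i v = representation (w ` {..d}) v (w i)"

context
  fixes w assumes w: "frame w"
begin

lemma coord_linear:
  "coord w i 0 = 0" "coord w i (u + v) = coord w i u + coord w i v"
  "coord w i (r *s v) = r * coord w i v" "coord w i (u - v) = coord w i u - coord w i v"
  "coord w i (sum f S) = (\<Sum>j\<in>S. coord w i (f j))"
  using w frame_basis(2)[OF w] unfolding coord_def frame_def
  by (simp_all add: representation_zero representation_add representation_scale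
      representation_diff representation_sum)

lemma sum_coord: "(\<Sum>i\<le>d. coord w i v *s w i) = v"
proof -
  have "(\<Sum>i\<le>d. coord w i v *s w i)
      = (\<Sum>b\<in>w ` {..d}. representation (w ` {..d}) v b *s b)"
    using frame_basis(1)[OF w] by (simp add: sum.reindex coord_def)
  also have "\<dots> = v"
    using w frame_basis(2)[OF w] by (intro sum_representation_eq) (auto simp: frame_def)
  finally show ?thesis .
qed

lemma coord_frame: "i \<le> d \<Longrightarrow> j \<le> d \<Longrightarrow> coord w i (w j) = (if i = j then 1 else 0)"
  using frame_basis[OF w] by (auto simp: coord_def representation_basis inj_on_def)

lemma frame_independent:
  assumes "(\<Sum>i\<le>d. x i *s w i) = 0" "j \<le> d"
  shows "x j = 0"
proof -
  have "0 = coord w j (\<Sum>i\<le>d. x i *s w i)" using assms(1) by (simp add: coord_linear)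
  also have "\<dots> = (\<Sum>i\<le>d. if j = i then x i else 0)"
    using assms(2) unfolding coord_linear by (intro sum.cong) (auto simp: coord_frame)
  also have "\<dots> = x j" using assms(2) by simp
  finally show ?thesis by simp
qed

lemma coord_span_lower:
  assumes "v \<in> span (w ` {..<i})" "i \<le> d"
  shows "coord w i v = 0"
  using assms(1)
  by (induction rule: span_induct_alt) (use assms(2) in \<open>auto simp: coord_linear coord_frame\<close>)

lemma sum_coord_compose:
  assumes "endo X"
  shows "coord w j (X v) = (\<Sum>k\<le>d. coord w k v * coord w j (X (w k)))"
proof -
  have "coord w j (X v) = coord w j (X (\<Sum>k\<le>d. coord w k v *s w k))" by (simp add: sum_coord)
  also have "\<dots> = (\<Sum>k\<le>d. coord w k v * coord w j (X (w k)))"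
    by (simp only: endo_simps[OF assms] coord_linear)
  finally show ?thesis .
qed

end

text \<open>Expand everything through \<open>w\<close>; summing over \<open>j\<close> first turns
  the two change-of-basis matrices into the identity.\<close>

lemma sum_coord_frame_indep:
  assumes w: "frame w" and w': "frame w'" and X: "endo X"
  shows "(\<Sum>j\<le>d. coord w' j (X (w' j))) = (\<Sum>i\<le>d. coord w i (X (w i)))"
proof -
  have expand: "coord w' j (X (w' j))
      = (\<Sum>i\<le>d. \<Sum>k\<le>d. coord w i (w' j) * coord w k (X (w i)) * coord w' j (w k))" for j
  proof -
    have "coord w' j (X (w' j))
        = coord w' j (\<Sum>i\<le>d. coord w i (w' j) *s (\<Sum>k\<le>d. coord w k (X (w i)) *s w k))"
      by (simp add: sum_coord[OF w] flip: endo_simps(5,6)[OF X])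
    also have "\<dots> = (\<Sum>i\<le>d. \<Sum>k\<le>d. coord w i (w' j) * coord w k (X (w i)) * coord w' j (w k))"
      by (simp add: coord_linear[OF w'] sum_distrib_left mult.assoc)
    finally show ?thesis .
  qed
  have "(\<Sum>j\<le>d. coord w' j (X (w' j)))
      = (\<Sum>i\<le>d. \<Sum>k\<le>d. \<Sum>j\<le>d. coord w i (w' j) * coord w k (X (w i)) * coord w' j (w k))"
    unfolding expand by (subst sum.swap, rule sum.cong, rule refl, subst sum.swap) simp
  also have "\<dots> = (\<Sum>i\<le>d. \<Sum>k\<le>d. coord w k (X (w i)) * coord w i (\<Sum>j\<le>d. coord w' j (w k) *s w' j))"
    by (simp add: coord_linear[OF w] sum_distrib_left mult_ac)
  also have "\<dots> = (\<Sum>i\<le>d. \<Sum>k\<le>d. if k = i then coord w k (X (w i)) else 0)"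
    by (intro sum.cong refl) (auto simp: sum_coord[OF w'] coord_frame[OF w])
  also have "\<dots> = (\<Sum>i\<le>d. coord w i (X (w i)))" by simp
  finally show ?thesis .
qed

section \<open>The trace, and operators triangular on a sequence\<close>

definition trace :: "('v \<Rightarrow> 'v) \<Rightarrow> 'a" where
  "trace X = (\<Sum>i\<le>d. coord (SOME w. frame w) i (X ((SOME w. frame w) i)))"

lemma frame_some: "frame (SOME w. frame w)"
  by (rule someI_ex[OF frame_exists])

lemma trace_frame: "frame w \<Longrightarrow> endo X \<Longrightarrow> trace X = (\<Sum>i\<le>d. coord w i (X (w i)))"
  unfolding trace_def by (rule sum_coord_frame_indep[OF _ frame_some])

lemma trace_add: "trace (\<lambda>v. X v + Y v) = trace X + trace Y"
  and trace_diff: "trace (\<lambda>v. X v - Y v) = trace X - trace Y"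
  and trace_scale: "trace (\<lambda>v. r *s X v) = r * trace X"
  by (simp_all add: trace_def coord_linear[OF frame_some] sum.distrib sum_subtractf
      sum_distrib_left)

lemma trace_id: "trace (\<lambda>v. v) = of_nat (Suc d)"
  unfolding trace_def by (simp add: coord_frame[OF frame_some])

lemma trace_commute:
  assumes X: "endo X" and Y: "endo Y"
  shows "trace (\<lambda>v. X (Y v)) = trace (\<lambda>v. Y (X v))"
proof -
  define w where "w = (SOME w. frame w)"
  have w: "frame w" unfolding w_def by (rule frame_some)
  have "trace (\<lambda>v. X (Y v))
      = (\<Sum>i\<le>d. \<Sum>k\<le>d. coord w k (Y (w i)) * coord w i (X (w k)))"
    unfolding trace_def w_def[symmetric] by (simp add: sum_coord_compose[OF w X, of _ "Y v" for v])
  also have "\<dots> = (\<Sum>k\<le>d. \<Sum>i\<le>d. coord w i (X (w k)) * coord w k (Y (w i)))"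
    by (subst sum.swap) (simp add: mult.commute)
  also have "\<dots> = trace (\<lambda>v. Y (X v))"
    unfolding trace_def w_def[symmetric] by (simp add: sum_coord_compose[OF w Y, of _ "X v" for v])
  finally show ?thesis .
qed

text \<open>The condition ranges over all \<open>i\<close>, also beyond \<open>d\<close>, so that it
  makes sense for a sequence of powers \<open>(Y ^^ i) u\<close> before it is known which of them
  form a basis.\<close>

definition triangular :: "(nat \<Rightarrow> 'v) \<Rightarrow> (nat \<Rightarrow> 'a) \<Rightarrow> ('v \<Rightarrow> 'v) \<Rightarrow> bool" where
  "triangular w t X \<longleftrightarrow> (\<forall>i. X (w i) - t i *s w i \<in> span (w ` {..<i}))"

lemma span_flag_mono: "(m::nat) \<le> n \<Longrightarrow> v \<in> span (w ` {..<m}) \<Longrightarrow> v \<in> span (w ` {..<n})"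
  using span_mono[OF image_mono[of "{..<m}" "{..<n}" w]] by auto

lemma triangular_flag:
  assumes X: "endo X" and t: "triangular w t X" and v: "v \<in> span (w ` {..<n})"
  shows "X v \<in> span (w ` {..<n})"
proof (rule endo_span_subset[OF X _ v])
  fix x assume "x \<in> w ` {..<n}"
  then obtain i where i: "i < n" "x = w i" by auto
  have "X (w i) - t i *s w i \<in> span (w ` {..<n})"
    by (rule span_flag_mono[of i]) (use t i in \<open>auto simp: triangular_def\<close>)
  moreover have "t i *s w i \<in> span (w ` {..<n})"
    using i by (intro span_scale span_base) auto
  ultimately have "(X (w i) - t i *s w i) + t i *s w i \<in> span (w ` {..<n})" by (rule span_add)
  then show "X x \<in> span (w ` {..<n})" using i by simp
qed

lemma trace_triangular:
  assumes "frame w" "endo X" "triangular w t X"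
  shows "trace X = (\<Sum>i\<le>d. t i)"
proof -
  have "coord w i (X (w i)) = t i" if "i \<le> d" for i
  proof -
    have "coord w i (X (w i) - t i *s w i) = 0"
      using assms(3) that coord_span_lower[OF assms(1)] unfolding triangular_def by blast
    then show ?thesis using that by (simp add: coord_linear[OF assms(1)] coord_frame[OF assms(1)])
  qed
  then show ?thesis using trace_frame[OF assms(1,2)] by simp
qed

lemma triangular_square:
  assumes X: "endo X" and t: "triangular w t X"
  shows "triangular w (\<lambda>i. t i * t i) (\<lambda>v. X (X v))"
  unfolding triangular_def
proof
  fix i
  have e: "X (X (w i)) - (t i * t i) *s w i
      = X (X (w i) - t i *s w i) + t i *s (X (w i) - t i *s w i)"
    by (simp add: endo_simps[OF X] scale_right_diff_distrib)
  have u: "X (w i) - t i *s w i \<in> span (w ` {..<i})" using t unfolding triangular_def by blast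
  show "X (X (w i)) - (t i * t i) *s w i \<in> span (w ` {..<i})"
    unfolding e by (intro span_add span_scale triangular_flag[OF X t] u)
qed

text \<open>The product of the commuting factors \<open>X - t j\<close>, \<open>j < n\<close>,
  applied to \<open>v\<close>: a Newton interpolation polynomial evaluated at the operator
  \<open>X\<close>.\<close>

primrec newton :: "(nat \<Rightarrow> 'a) \<Rightarrow> ('v \<Rightarrow> 'v) \<Rightarrow> nat \<Rightarrow> 'v \<Rightarrow> 'v" where
  "newton t X 0 v = v"
| "newton t X (Suc n) v = X (newton t X n v) - t n *s newton t X n v"

text \<open>The product commutes with \<open>X - r\<close>, so a factor can also be split off at the
  inner end, whereas the recursion of \<open>newton\<close> splits off the outer one.\<close>

lemma newton_linear:
  assumes X: "endo X"
  shows "newton t X n (X v - r *s v) = X (newton t X n v) - r *s newton t X n v"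
proof (induction n)
  case (Suc n)
  show ?case by (simp add: Suc endo_simps[OF X] scale_right_diff_distrib mult.commute)
qed simp

text \<open>Cayley-Hamilton for a flag: \<open>X - t n\<close> pushes the span of the first
  \<open>n + 1\<close> vectors into the span of the first \<open>n\<close>.\<close>

lemma newton_triangular:
  assumes X: "endo X" and t: "triangular w t X"
  shows "v \<in> span (w ` {..<n}) \<Longrightarrow> newton t X n v = 0"
proof (induction n arbitrary: v)
  case (Suc n)
  have endo': "endo (\<lambda>v. X v - t n *s v)"
    by (rule endoI) (simp_all add: endo_simps[OF X] algebra_simps)
  have "X v - t n *s v \<in> span (w ` {..<n})"
  proof (rule endo_span_subset[OF endo' _ Suc.prems])
    fix x assume "x \<in> w ` {..<Suc n}"
    then consider i where "i < n" "x = w i" | "x = w n" by (auto simp: less_Suc_eq)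
    then show "X x - t n *s x \<in> span (w ` {..<n})"
    proof cases
      case 1
      then have "x \<in> span (w ` {..<n})" by (auto intro: span_base)
      then show ?thesis by (intro span_diff span_scale triangular_flag[OF X t])
    qed (use t in \<open>auto simp: triangular_def\<close>)
  qed
  then show ?case using Suc.IH newton_linear[OF X, of t n v "t n"] by simp
qed simp

lemma newton_frame_zero:
  assumes "endo X" "triangular w t X" "frame w"
  shows "newton t X (Suc d) v = 0"
  by (rule newton_triangular[OF assms(1,2)])
    (use assms(3) in \<open>auto simp: frame_def lessThan_Suc_atMost\<close>)

text \<open>Powers and Newton products differ by a unitriangular change. It suffices to place the
  powers in the span of the Newton products, \<open>frame\<close> being a spanning
  condition.\<close>

lemma frame_newton:
  assumes Y: "endo Y" and f: "frame (\<lambda>i. (Y ^^ i) u)"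
  shows "frame (\<lambda>i. newton t Y i u)"
proof -
  define S where "S n = span ((\<lambda>i. newton t Y i u) ` {..<n})" for n
  have base: "newton t Y i u \<in> S n" if "i < n" for i n
    unfolding S_def using that by (intro span_base) auto
  have step: "Y v \<in> S (Suc n)" if "v \<in> S n" for v n
    using that unfolding S_def
  proof (rule endo_span_subset[OF Y, rotated])
    fix x assume "x \<in> (\<lambda>i. newton t Y i u) ` {..<n}"
    then obtain i where i: "i < n" "x = newton t Y i u" by auto
    have "Y x = newton t Y (Suc i) u + t i *s newton t Y i u" using i by simp
    also have "\<dots> \<in> S (Suc n)"
      using base[of "Suc i" "Suc n"] base[of i "Suc n"] i unfolding S_def
      by (intro span_add span_scale) auto
    finally show "Y x \<in> span ((\<lambda>i. newton t Y i u) ` {..<Suc n})" unfolding S_def .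
  qed
  have "(Y ^^ i) u \<in> S (Suc i)" for i
    using base[of 0 1] by (induction i) (auto simp: step)
  then have "(Y ^^ i) u \<in> S (Suc d)" if "i \<le> d" for i
    using that span_flag_mono[of "Suc i" "Suc d"] unfolding S_def by (metis Suc_le_mono)
  then have "span ((\<lambda>i. (Y ^^ i) u) ` {..d}) \<subseteq> S (Suc d)"
    unfolding S_def by (intro span_minimal) auto
  then show ?thesis using f unfolding frame_def S_def by (auto simp: lessThan_Suc_atMost)
qed

section \<open>Cyclic bases in an irreducible module\<close>

lemma flag_independent:
  assumes "\<And>i. i < n \<Longrightarrow> w i \<notin> span (w ` {..<i})"
  shows "independent (w ` {..<n}) \<and> card (w ` {..<n}) = n"
  using assms
proof (induction n)
  case (Suc n)
  then have n: "w n \<notin> span (w ` {..<n})" by simp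
  then have "w n \<notin> w ` {..<n}" using span_base[of "w n" "w ` {..<n}"] by blast
  then show ?case using Suc n by (simp add: lessThan_Suc independent_insert)
qed (simp add: independent_empty)

lemma flag_dependent: "\<exists>m::nat. w m \<in> span (w ` {..<m})"
proof (rule ccontr)
  assume "\<not> ?thesis"
  then have *: "independent (w ` {..<d + 2}) \<and> card (w ` {..<d + 2}) = d + 2"
    by (intro flag_independent) auto
  obtain f where "frame f" using frame_exists by blast
  then have "w ` {..<d + 2} \<subseteq> span (f ` {..d})" by (simp add: frame_def)
  then have "d + 2 \<le> card (f ` {..d})"
    using * independent_span_bound[of "f ` {..d}" "w ` {..<d + 2}"] by auto
  moreover have "card (f ` {..d}) \<le> card {..d}" by (rule card_image_le) simp
  ultimately show False by simp
qed

text \<open>Let \<open>m\<close> be the first index whose power depends on the earlier ones. The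
  span of the earlier powers is stable under \<open>Y\<close> by choice of \<open>m\<close> and
  under \<open>X\<close> by triangularity, so it is the whole space, and counting gives
  \<open>m = Suc d\<close>.\<close>

lemma frame_cyclic:
  assumes X: "endo X" and Y: "endo Y" and u: "u \<noteq> 0"
    and t: "triangular (\<lambda>i. (Y ^^ i) u) t X"
    and irr: "\<And>W. subspace W \<Longrightarrow> X ` W \<subseteq> W \<Longrightarrow> Y ` W \<subseteq> W \<Longrightarrow> W = {0} \<or> W = UNIV"
  shows "frame (\<lambda>i. (Y ^^ i) u)"
proof -
  define w where "w i = (Y ^^ i) u" for i
  obtain m where m: "w m \<in> span (w ` {..<m})"
    and least: "\<And>i. i < m \<Longrightarrow> w i \<notin> span (w ` {..<i})"
    using flag_dependent[of w] exists_least_iff[of "\<lambda>m. w m \<in> span (w ` {..<m})"] by blast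
  have ind: "independent (w ` {..<m})" "card (w ` {..<m}) = m"
    using flag_independent[of m w] least by auto
  have "w 0 = u" by (simp add: w_def)
  then have "0 < m" using m u by (cases m) auto
  have "Y v \<in> span (w ` {..<m})" if v: "v \<in> span (w ` {..<m})" for v
  proof (rule endo_span_subset[OF Y _ v])
    fix x assume "x \<in> w ` {..<m}"
    then obtain i where i: "i < m" "Y x = w (Suc i)" by (auto simp: w_def)
    show "Y x \<in> span (w ` {..<m})"
      using i m by (cases "Suc i = m") (auto intro: span_base)
  qed
  moreover have "triangular w t X" using t by (simp add: w_def[abs_def])
  then have "X v \<in> span (w ` {..<m})" if "v \<in> span (w ` {..<m})" for v
    using triangular_flag X that by blast
  moreover have "u \<in> span (w ` {..<m})"
    using \<open>0 < m\<close> \<open>w 0 = u\<close> by (intro span_base) auto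
  ultimately have U: "span (w ` {..<m}) = UNIV"
    using irr[of "span (w ` {..<m})"] u by (auto simp: image_subset_iff)
  then have "m = Suc d"
    using ind dim_eq_card[of "w ` {..<m}" UNIV] dim_UNIV_eq by simp
  then show ?thesis
    using U unfolding frame_def w_def[abs_def] by (simp add: lessThan_Suc_atMost)
qed

end

section \<open>Eigenvectors\<close>

locale vector_space_dim_alg_closed = vector_space_dim scale d
  for scale :: "'a::alg_closed_field \<Rightarrow> 'v::ab_group_add \<Rightarrow> 'v" (infixr \<open>*s\<close> 75) and d
begin

section \<open>Polynomials in an operator; existence and finiteness of eigenvalues\<close>

definition poly_act :: "('v \<Rightarrow> 'v) \<Rightarrow> 'a poly \<Rightarrow> 'v \<Rightarrow> 'v" where
  "poly_act X p v = (\<Sum>i\<le>degree p. coeff p i *s (X ^^ i) v)"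

lemma poly_act_le:
  assumes "degree p \<le> n"
  shows "poly_act X p v = (\<Sum>i\<le>n. coeff p i *s (X ^^ i) v)"
  unfolding poly_act_def using assms
  by (intro sum.mono_neutral_left) (auto simp: coeff_eq_0)

lemma poly_act_add: "poly_act X (p + q) v = poly_act X p v + poly_act X q v"
proof -
  define n where "n = max (degree p) (degree q)"
  have "degree (p + q) \<le> n" "degree p \<le> n" "degree q \<le> n"
    by (auto simp: n_def degree_add_le_max)
  then show ?thesis by (simp add: poly_act_le scale_left_distrib sum.distrib)
qed

lemma poly_act_smult: "poly_act X (smult r p) v = r *s poly_act X p v"
  by (simp add: poly_act_le[OF degree_smult_le] poly_act_le[OF order_refl] scale_sum_right)

lemma poly_act_monom: "poly_act X (monom r n) v = r *s (X ^^ n) v"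
proof -
  have "poly_act X (monom r n) v = (\<Sum>i\<le>n. (if i = n then r *s (X ^^ i) v else 0))"
    unfolding poly_act_le[OF degree_monom_le] by (intro sum.cong) auto
  then show ?thesis by simp
qed

lemma poly_act_pCons_0:
  assumes X: "endo X"
  shows "poly_act X (pCons 0 p) v = X (poly_act X p v)"
proof -
  have "poly_act X (pCons 0 p) v = (\<Sum>i\<le>Suc (degree p). coeff (pCons 0 p) i *s (X ^^ i) v)"
    by (intro poly_act_le degree_pCons_le)
  also have "\<dots> = (\<Sum>i\<le>degree p. coeff p i *s X ((X ^^ i) v))"
    by (subst sum.atMost_Suc_shift) simp
  also have "\<dots> = X (poly_act X p v)"
    by (simp add: poly_act_def endo_simps[OF X])
  finally show ?thesis .
qed

lemma poly_act_linear_factor: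
  assumes X: "endo X"
  shows "poly_act X ([:- r, 1:] * p) v = X (poly_act X p v) - r *s poly_act X p v"
proof -
  have "[:- r, 1:] * p = smult (- r) p + pCons 0 p" by simp
  then show ?thesis
    by (simp only: poly_act_add poly_act_smult poly_act_pCons_0[OF X] scale_minus_left) simp
qed

lemma annihilating_poly_exists: "\<exists>p. p \<noteq> 0 \<and> poly_act X p v = 0"
proof -
  define w where "w i = (X ^^ i) v" for i
  obtain m where m: "w m \<in> span (w ` {..<m})" using flag_dependent by blast
  \<comment> \<open>Compared with a degree bound, \<open>coeff q m = 0\<close> is a linear
    condition, and it still ensures that \<open>monom 1 m - q\<close> is nonzero.\<close>
  define W where "W = {poly_act X q v | q. coeff q m = 0}"
  have W: "poly_act X q v \<in> W" if "coeff q m = 0" for q using that by (auto simp: W_def)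
  have "subspace W"
    unfolding subspace_def
  proof (intro conjI ballI allI)
    show "0 \<in> W" using W[of 0] by (simp add: poly_act_def)
    show "x + y \<in> W" if "x \<in> W" "y \<in> W" for x y
    proof -
      obtain p q where "x = poly_act X p v" "coeff p m = 0" "y = poly_act X q v" "coeff q m = 0"
        using \<open>x \<in> W\<close> \<open>y \<in> W\<close> by (auto simp: W_def)
      then show ?thesis using W[of "p + q"] by (simp add: poly_act_add)
    qed
    show "r *s x \<in> W" if "x \<in> W" for r x
    proof -
      obtain p where "x = poly_act X p v" "coeff p m = 0"
        using \<open>x \<in> W\<close> by (auto simp: W_def)
      then show ?thesis using W[of "smult r p"] by (simp add: poly_act_smult)
    qed
  qed
  moreover have "w ` {..<m} \<subseteq> W"
  proof
    fix x assume "x \<in> w ` {..<m}"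
    then obtain i where "i < m" "x = w i" by auto
    then show "x \<in> W" using W[of "monom 1 i"] by (simp add: poly_act_monom w_def)
  qed
  ultimately have "w m \<in> W" using m span_minimal by blast
  then obtain q where q: "w m = poly_act X q v" "coeff q m = 0" by (auto simp: W_def)
  have "coeff (monom 1 m + smult (- 1) q) m = 1" using q(2) by simp
  then have "monom 1 m + smult (- 1) q \<noteq> 0" by (metis coeff_0 zero_neq_one)
  moreover have "poly_act X (monom 1 m + smult (- 1) q) v = 0"
    unfolding poly_act_add poly_act_smult poly_act_monom using q(1) by (simp add: w_def)
  ultimately show ?thesis by blast
qed

definition eigen :: "('v \<Rightarrow> 'v) \<Rightarrow> 'a \<Rightarrow> bool" where
  "eigen X r \<longleftrightarrow> (\<exists>u. u \<noteq> 0 \<and> X u = r *s u)"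

text \<open>Take a nonzero polynomial of least degree that annihilates one nonzero vector
  \<open>v\<close>. Splitting off a root \<open>r\<close> leaves a factor \<open>q\<close> that does
  not annihilate \<open>v\<close>, and \<open>poly_act X q v\<close> is the eigenvector.\<close>

lemma eigen_exists:
  assumes X: "endo X"
  shows "\<exists>r. eigen X r"
proof -
  have "\<exists>v :: 'v. v \<noteq> 0"
  proof (rule ccontr)
    assume "\<not> ?thesis"
    then have "span {} = (UNIV :: 'v set)" by auto
    then have "dim (UNIV :: 'v set) = 0" using dim_span[of "{}"] dim_eq_card_independent[of "{}"]
      by (simp add: independent_empty)
    then show False using dim_UNIV_eq by simp
  qed
  then obtain v :: 'v where v: "v \<noteq> 0" by blast
  obtain p where p: "p \<noteq> 0" "poly_act X p v = 0"
    and least: "\<And>q. degree q < degree p \<Longrightarrow> q \<noteq> 0 \<Longrightarrow> poly_act X q v \<noteq> 0"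
  proof -
    define P where "P n \<longleftrightarrow> (\<exists>p. p \<noteq> 0 \<and> poly_act X p v = 0 \<and> degree p = n)" for n
    have "\<exists>n. P n" using annihilating_poly_exists[of X v] by (auto simp: P_def)
    then obtain n where "P n" "\<And>k. k < n \<Longrightarrow> \<not> P k" using exists_least_iff[of P] by blast
    then show ?thesis using that unfolding P_def by metis
  qed
  have "degree p > 0"
  proof (rule ccontr)
    assume "\<not> ?thesis"
    then have "degree p = 0" by simp
    then have "coeff p 0 \<noteq> 0" "poly_act X p v = coeff p 0 *s v"
      using p(1) by (auto simp: poly_act_def elim: degree_eq_zeroE)
    then show False using p(2) v by simp
  qed
  then obtain r where "poly p r = 0" using alg_closed_imp_poly_has_root by blast
  then obtain q where q: "p = [:- r, 1:] * q" by (auto simp: poly_eq_0_iff_dvd elim: dvdE)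
  have "q \<noteq> 0" using p(1) q by auto
  moreover from this have "degree p = Suc (degree q)"
    unfolding q by (subst degree_mult_eq) auto
  ultimately have "poly_act X q v \<noteq> 0" using least by simp
  moreover have "X (poly_act X q v) = r *s poly_act X q v"
    using p(2) unfolding q poly_act_linear_factor[OF X] by simp
  ultimately show ?thesis unfolding eigen_def by blast
qed

lemma newton_eigenvector:
  assumes X: "endo X" and "X u = r *s u"
  shows "newton t X n u = (\<Prod>j<n. r - t j) *s u"
  by (induction n) (simp_all add: assms(2) endo_simps[OF X] scale_left_diff_distrib mult.commute
      left_diff_distrib)

text \<open>On eigenvectors for infinitely many distinct eigenvalues, the Newton product of the
  earlier eigenvalues kills the first vector that depends on its predecessors, but also scales it by
  a product of nonzero differences.\<close>

lemma finite_eigen: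
  assumes X: "endo X"
  shows "finite {r. eigen X r}"
proof (rule ccontr)
  assume "infinite {r. eigen X r}"
  then obtain t :: "nat \<Rightarrow> 'a" where t: "inj t" "\<And>i. eigen X (t i)"
    using infinite_countable_subset[of "{r. eigen X r}"] by blast
  then obtain f where f: "\<And>i. f i \<noteq> 0" "\<And>i. X (f i) = t i *s f i"
    unfolding eigen_def by metis
  obtain m where m: "f m \<in> span (f ` {..<m})" using flag_dependent by blast
  have "triangular f t X" unfolding triangular_def by (simp add: f span_zero)
  then have "newton t X m (f m) = 0" using newton_triangular[OF X _ m] by blast
  then have "(\<Prod>j<m. t m - t j) = 0"
    using newton_eigenvector[OF X f(2)] f(1) by simp
  then show False using t(1) by (auto simp: inj_def)
qed

end

section \<open>Racah pairs\<close>

text \<open>Over an algebraically closed field every eigenvalue has the form \<open>theta x\<close>,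
  with \<open>x\<close> unique only up to exchanging \<open>x\<close> and \<open>- 1 - x\<close>.
  Unit shifts of \<open>x\<close> then give the ladder of eigenvalues.\<close>

definition theta :: "'a::field \<Rightarrow> 'a" where
  "theta x = x * (x + 1)"

locale racah_pair = vector_space_dim_alg_closed scale d
  for scale :: "'a::{alg_closed_field, field_char_0} \<Rightarrow> 'v::ab_group_add \<Rightarrow> 'v" (infixr \<open>*s\<close> 75)
    and d +
  fixes X Y :: "'v \<Rightarrow> 'v" and \<kappa> \<mu> \<delta> :: 'a
  assumes X: "endo X" and Y: "endo Y"
    and XXY: "\<And>v. X (X (Y v)) = 2 *s X (Y (X v)) - Y (X (X v))
      + 2 *s (X (X v) + X (Y v) + Y (X v)) - (2 * \<delta>) *s X v + (2 * \<kappa>) *s v"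
    and YYX: "\<And>v. Y (Y (X v)) = 2 *s Y (X (Y v)) - X (Y (Y v))
      + 2 *s (Y (Y v) + X (Y v) + Y (X v)) - (2 * \<delta>) *s Y v + (2 * \<mu>) *s v"
    and irreducible: "\<And>W. subspace W \<Longrightarrow> X ` W \<subseteq> W \<Longrightarrow> Y ` W \<subseteq> W \<Longrightarrow> W = {0} \<or> W = UNIV"
begin

text \<open>Climb from any eigenvalue along \<open>theta (x + of_nat n)\<close>: the eigenvalues are
  finite in number and each is met for finitely many \<open>n\<close>, so there is a last
  one.\<close>

lemma top_eigenvalue: "\<exists>x. eigen X (theta x) \<and> \<not> eigen X (theta (x + 1))"
proof -
  obtain r where r: "eigen X r" using eigen_exists[OF X] by blast
  obtain x where "poly [:- r, 1, 1:] x = 0"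
    using alg_closed_imp_poly_has_root[of "[:- r, 1, 1:]"] by auto
  then have x: "theta x = r" by (simp add: theta_def algebra_simps)
  define N where "N = {n. eigen X (theta (x + of_nat n))}"
  \<comment> \<open>The quadratic in \<open>y\<close> is \<open>theta (x + y) - s\<close>.\<close>
  have "N = of_nat -` (\<Union>s\<in>{s. eigen X s}. {y. poly [:x * x + x - s, 2 * x + 1, 1:] y = 0})"
    by (auto simp: N_def theta_def algebra_simps)
  moreover have "finite \<dots>"
    by (intro finite_vimageI finite_UN_I finite_eigen X poly_roots_finite inj_of_nat) auto
  ultimately have fin: "finite N" by simp
  have "0 \<in> N" using r x by (simp add: N_def)
  then have "Max N \<in> N" using fin by (intro Max_in) auto
  moreover have "Suc (Max N) \<notin> N" using Max_ge[OF fin, of "Suc (Max N)"] by auto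
  ultimately have "eigen X (theta (x + of_nat (Max N)))"
    "\<not> eigen X (theta (x + of_nat (Suc (Max N))))"
    unfolding N_def by blast+
  then show ?thesis by (intro exI[of _ "x + of_nat (Max N)"]) (simp add: add_ac)
qed

text \<open>The first relation at \<open>u\<close> says that
  \<open>(X - theta (x + 1)) (X - theta (x - 1))\<close> sends \<open>Y u\<close> to a multiple of
  \<open>u\<close>. The number \<open>s\<close> is chosen so that subtracting \<open>s *s u\<close>
  absorbs this multiple, and the resulting \<open>q\<close> would be an eigenvector for
  \<open>theta (x + 1)\<close>. The factor \<open>x + 1\<close> comes from
  \<open>theta x - theta (x + 1) = - 2 * (x + 1)\<close>.\<close>

lemma XY_top_eigenvector:
  assumes u: "X u = theta x *s u" and top: "\<not> eigen X (theta (x + 1))"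
    and s: "(x + 1) * s = - (theta x * theta x - \<delta> * theta x + \<kappa>)"
  shows "X (Y u) = theta (x - 1) *s Y u + s *s u"
proof -
  define q where "q = X (Y u) - theta (x - 1) *s Y u - s *s u"
  have XXYu: "X (X (Y u)) = (2 * theta x + 2) *s X (Y u) + (2 * theta x - theta x * theta x) *s Y u
      + (2 * (theta x * theta x) - 2 * \<delta> * theta x + 2 * \<kappa>) *s u"
    unfolding XXY[of u] u endo_simps[OF X] endo_simps[OF Y] by (simp add: algebra_simps)
  have c1: "2 * theta x + 2 - theta (x - 1) = theta (x + 1)"
    and c2: "2 * theta x - theta x * theta x = - theta (x + 1) * theta (x - 1)"
    by (simp_all add: theta_def algebra_simps)
  have "2 * (theta x * theta x) - 2 * \<delta> * theta x + 2 * \<kappa> - s * theta x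
      = - 2 * ((x + 1) * s) - s * theta x"
    unfolding s by (simp add: algebra_simps)
  also have "\<dots> = - theta (x + 1) * s" by (simp add: theta_def algebra_simps)
  finally have c3: "2 * (theta x * theta x) - 2 * \<delta> * theta x + 2 * \<kappa> - s * theta x
      = - theta (x + 1) * s" .
  have "X q = (2 * theta x + 2 - theta (x - 1)) *s X (Y u)
      + (2 * theta x - theta x * theta x) *s Y u
      + (2 * (theta x * theta x) - 2 * \<delta> * theta x + 2 * \<kappa> - s * theta x) *s u"
    unfolding q_def endo_simps[OF X] XXYu u by (simp add: algebra_simps)
  also have "\<dots> = theta (x + 1) *s q"
    unfolding c1 c2 c3 q_def by (simp add: scale_right_diff_distrib)
  finally have "q = 0" using top unfolding eigen_def by blast
  then show ?thesis by (simp add: q_def algebra_simps)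
qed

text \<open>Solved for \<open>X (Y (Y v))\<close>, the second relation is a recursion that
  determines \<open>X\<close> on each power of \<open>Y\<close> from its values on the two preceding
  ones.\<close>

lemma triangular_cyclic:
  assumes u: "X u = theta x *s u" and Yu: "X (Y u) = theta (x - 1) *s Y u + s *s u"
  shows "triangular (\<lambda>i. (Y ^^ i) u) (\<lambda>i. theta (x - of_nat i)) X"
proof -
  define w where "w i = (Y ^^ i) u" for i
  define t where "t i = theta (x - of_nat i)" for i
  define S where "S i = span (w ` {..<i})" for i
  define r where "r i = X (w i) - t i *s w i" for i
  have base: "w i \<in> S n" if "i < n" for i n
    unfolding S_def using that by (intro span_base) auto
  have mono: "v \<in> S m \<Longrightarrow> m \<le> n \<Longrightarrow> v \<in> S n" for v m n
    unfolding S_def using span_flag_mono by blast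
  have Yw: "Y (w i) = w (Suc i)" for i by (simp add: w_def)
  have YS: "Y v \<in> S (Suc n)" if v: "v \<in> S n" for v n
    unfolding S_def
  proof (rule endo_span_subset[OF Y _ v[unfolded S_def]])
    fix z assume "z \<in> w ` {..<n}"
    then show "Y z \<in> span (w ` {..<Suc n})" using base Yw unfolding S_def by auto
  qed
  \<comment> \<open>The recursion has depth two, so two consecutive remainders are carried
    along.\<close>
  have "r i \<in> S i \<and> r (Suc i) \<in> S (Suc i)" for i
  proof (induction i)
    case 0
    have "r 0 = 0" by (simp add: r_def w_def t_def u)
    moreover have "r 1 = s *s w 0" by (simp add: r_def w_def t_def Yu)
    ultimately show ?case using base[of 0 1] by (simp add: S_def span_zero span_scale)
  next
    case (Suc i)
    define j where "j = Suc i"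
    have Xw: "X (w i) = r i + t i *s w i" "X (w j) = r j + t j *s w j"
      by (simp_all add: r_def)
    \<comment> \<open>A monic quadratic has constant second difference 2; this matches the leading
      coefficient in the recursion.\<close>
    have tj: "t (Suc j) = 2 * t j - t i + 2"
      by (simp add: t_def j_def theta_def algebra_simps)
    have "X (w (Suc j)) = 2 *s Y (X (w j)) - Y (Y (X (w i)))
        + 2 *s (w (Suc j) + X (w j) + Y (X (w i))) - (2 * \<delta>) *s w j + (2 * \<mu>) *s w i"
      using YYX[of "w i"] by (simp add: Yw j_def algebra_simps)
    also have "\<dots> = 2 *s Y (r j) - Y (Y (r i)) + 2 *s (r j + t j *s w j + Y (r i) + t i *s w j)
        - (2 * \<delta>) *s w j + (2 * \<mu>) *s w i + t (Suc j) *s w (Suc j)"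
      unfolding Xw tj endo_simps[OF Y] Yw j_def[symmetric] by (simp add: algebra_simps)
    finally have "r (Suc j) = 2 *s Y (r j) - Y (Y (r i))
        + 2 *s (r j + t j *s w j + Y (r i) + t i *s w j) - (2 * \<delta>) *s w j + (2 * \<mu>) *s w i"
      by (simp add: r_def)
    moreover have "Y (r j) \<in> S (Suc j)" "Y (Y (r i)) \<in> S (Suc j)" "r j \<in> S (Suc j)"
      "Y (r i) \<in> S (Suc j)" "w j \<in> S (Suc j)" "w i \<in> S (Suc j)"
      using Suc YS base mono[of _ j "Suc j"] by (auto simp: j_def)
    ultimately have "r (Suc j) \<in> S (Suc j)"
      unfolding S_def by (simp add: span_add span_diff span_scale)
    then show ?case using Suc by (simp add: j_def)
  qed
  then show ?thesis
    unfolding triangular_def r_def S_def t_def w_def by blast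
qed

lemma cyclic_frame_exists:
  obtains x u s where "u \<noteq> 0" "X u = theta x *s u" "X (Y u) = theta (x - 1) *s Y u + s *s u"
    "x + 1 \<noteq> 0" "(x + 1) * s = - (theta x * theta x - \<delta> * theta x + \<kappa>)"
    "frame (\<lambda>i. (Y ^^ i) u)"
    "triangular (\<lambda>i. (Y ^^ i) u) (\<lambda>i. theta (x - of_nat i)) X"
proof -
  obtain x where x: "eigen X (theta x)" "\<not> eigen X (theta (x + 1))"
    using top_eigenvalue by blast
  then obtain u where u: "u \<noteq> 0" "X u = theta x *s u" unfolding eigen_def by blast
  \<comment> \<open>At \<open>x = -1\<close> the values \<open>theta x\<close> and
    \<open>theta (x + 1)\<close> coincide, yet only the first is an eigenvalue.\<close>
  have "x + 1 \<noteq> 0"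
  proof
    assume "x + 1 = 0"
    then have "theta (x + 1) = theta x" by (simp add: theta_def)
    then show False using x by simp
  qed
  define s where "s = - (theta x * theta x - \<delta> * theta x + \<kappa>) / (x + 1)"
  have s: "(x + 1) * s = - (theta x * theta x - \<delta> * theta x + \<kappa>)"
    using \<open>x + 1 \<noteq> 0\<close> unfolding s_def by simp
  have Yu: "X (Y u) = theta (x - 1) *s Y u + s *s u"
    by (rule XY_top_eigenvector[OF u(2) x(2) s])
  note t = triangular_cyclic[OF u(2) Yu]
  show ?thesis
    by (rule that[OF u Yu \<open>x + 1 \<noteq> 0\<close> s frame_cyclic[OF X Y u(1) t irreducible] t])
qed

text \<open>The double commutator has trace zero, so half the trace of the remaining side of the
  first relation vanishes.\<close>

lemma trace_relation:
  "trace (\<lambda>v. X (X v)) + 2 * trace (\<lambda>v. X (Y v)) - \<delta> * trace X + \<kappa> * of_nat (Suc d) = 0"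
proof -
  note XX = endo_compose[OF X X] and XY = endo_compose[OF X Y]
  have c: "trace (\<lambda>v. X (X (Y v))) = trace (\<lambda>v. X (Y (X v)))"
    "trace (\<lambda>v. Y (X (X v))) = trace (\<lambda>v. X (X (Y v)))"
    "trace (\<lambda>v. Y (X v)) = trace (\<lambda>v. X (Y v))"
    using trace_commute[OF X XY] trace_commute[OF Y XX] trace_commute[OF Y X] by simp_all
  have "trace (\<lambda>v. X (X (Y v))) = trace (\<lambda>v. 2 *s X (Y (X v)) - Y (X (X v))
      + 2 *s (X (X v) + X (Y v) + Y (X v)) - (2 * \<delta>) *s X v + (2 * \<kappa>) *s v)"
    by (simp only: XXY)
  then have "2 * (trace (\<lambda>v. X (X v)) + 2 * trace (\<lambda>v. X (Y v)) - \<delta> * trace X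
      + \<kappa> * of_nat (Suc d)) = 0"
    unfolding trace_add trace_diff trace_scale trace_id c by (simp add: algebra_simps)
  then show ?thesis by (metis mult_eq_0_iff zero_neq_numeral)
qed

end

text \<open>Here \<open>(2 * x - n) * (2 * x - n + 2)\<close> is
  \<open>4 * theta (x - n / 2)\<close>: the sum depends on \<open>x\<close> only through its centred
  value, and so does the sum of squares below. The factors 12 and 240 clear denominators, making the
  inductions polynomial identities.\<close>

lemma sum_theta:
  fixes x :: "'a::field_char_0"
  shows "(\<Sum>i\<le>n. theta (x - of_nat i)) * 12
    = (of_nat n + 1) * (3 * (2 * x - of_nat n) * (2 * x - of_nat n + 2) + of_nat n * (of_nat n + 2))"
  by (induction n) (simp_all add: theta_def algebra_simps)

lemma sum_theta_square:
  fixes x :: "'a::field_char_0"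
  shows "(\<Sum>i\<le>n. theta (x - of_nat i) * theta (x - of_nat i)) * 240
    = (of_nat n + 1) * (15 * ((2 * x - of_nat n) * (2 * x - of_nat n + 2))\<^sup>2
      + (30 * ((2 * x - of_nat n) * (2 * x - of_nat n + 2)) + 20) * (of_nat n * (of_nat n + 2))
      + of_nat n * (of_nat n + 2) * (3 * (of_nat n + 1)\<^sup>2 - 7))"
  by (induction n) (simp_all add: theta_def algebra_simps power2_eq_square)

text \<open>Intended reading: \<open>p\<close>, \<open>r\<close>, \<open>s\<close> are
  \<open>theta\<close> at the parameters of \<open>A\<close>, \<open>B\<close>, \<open>C\<close>,
  and \<open>u\<close>, \<open>w\<close> are the traces of \<open>AB\<close> and \<open>CA\<close>
  divided by \<open>d + 1\<close>. The system is linear in \<open>al\<close>, \<open>be\<close>,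
  \<open>u\<close>, \<open>w\<close>: the first two equations give \<open>al\<close> and
  \<open>be\<close> in terms of \<open>u\<close>, the last gives \<open>w\<close>, and the third
  then fixes \<open>u\<close>.\<close>

lemma racah_parameters:
  fixes p r s m q al be u w \<delta> :: "'a::comm_ring_1"
  defines "sq \<equiv> \<lambda>z. z\<^sup>2 + (6 * z + 1) * m + q"
  assumes \<delta>: "\<delta> = p + r + s + 3 * m"
    and p: "sq p + 2 * u - \<delta> * (p + m) + al = 0"
    and r: "sq r + 2 * u - \<delta> * (r + m) - be = 0"
    and s: "sq s + 2 * w - \<delta> * (s + m) - (al + be) = 0"
    and uw: "u + w = \<delta> * (p + m) - sq p"
  shows "al = (s - r) * (p - 3 * m)" "be = (p - s) * (r - 3 * m)"
proof -
  have be: "be = sq r + 2 * u - \<delta> * (r + m)" and al: "al = \<delta> * (p + m) - sq p - 2 * u"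
    using p r by (simp_all add: algebra_simps eq_neg_iff_add_eq_0)
  have w: "w = \<delta> * (p + m) - sq p - u" using uw by (simp add: algebra_simps)
  have u: "2 * u = sq s - sq r - sq p + \<delta> * (p + m) - \<delta> * (s + m) + \<delta> * (r + m)"
    using s unfolding be al w by (simp add: algebra_simps)
  show "al = (s - r) * (p - 3 * m)" unfolding al u unfolding sq_def \<delta>
    by (simp add: algebra_simps power2_eq_square)
  show "be = (p - s) * (r - 3 * m)" unfolding be u unfolding sq_def \<delta>
    by (simp add: algebra_simps power2_eq_square)
qed

section \<open>Irreducible modules\<close>

locale racah_irr = vector_space_dim_alg_closed scale d
  for scale :: "'a::{alg_closed_field, field_char_0} \<Rightarrow> 'v::ab_group_add \<Rightarrow> 'v" (infixr \<open>*s\<close> 75)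
    and d +
  fixes A B C D :: "'v \<Rightarrow> 'v" and \<alpha> \<beta> \<delta> :: 'a
  assumes A: "endo A" and B: "endo B" and D: "endo D"
    and AB: "\<And>v. 2 *s D v = A (B v) - B (A v)"
    and C: "\<And>v. C v = \<delta> *s v - A v - B v"
    and alpha: "\<And>v. A (D v) - D (A v) + A (C v) - B (A v) = \<alpha> *s v"
    and beta: "\<And>v. B (D v) - D (B v) + B (A v) - C (B v) = \<beta> *s v"
    and irreducible: "\<And>W. subspace W \<Longrightarrow> A ` W \<subseteq> W \<Longrightarrow> B ` W \<subseteq> W \<Longrightarrow> C ` W \<subseteq> W \<Longrightarrow> D ` W \<subseteq> W
      \<Longrightarrow> W = {0} \<or> W = UNIV"
begin

section \<open>Double commutator relations for the pairs of generators\<close>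

lemma endo_C: "endo C"
  by (rule endoI) (simp_all add: C endo_simps[OF A] endo_simps[OF B] algebra_simps)

text \<open>Doublings are written as sums so that \<open>algebra_simps\<close> can cancel
  terms.\<close>

lemma scale_two: "2 *s v = v + v" "(2 * k) *s v = k *s v + k *s v"
    "(k * 2) *s v = k *s v + k *s v" "(k * (l * 2)) *s v = (k * l) *s v + (k * l) *s v"
  using scale_left_distrib[of 1 1 v] by (simp_all flip: scale_left_distrib)

lemma D_eq: "D v = (1 / 2) *s (A (B v) - B (A v))"
  unfolding AB[symmetric] by simp

text \<open>Double the relation for \<alpha>, replace \<open>2 *s D\<close> by the commutator of
  \<open>A\<close> and \<open>B\<close>, and eliminate \<open>C\<close>.\<close>

lemma AAB: "A (A (B v)) = 2 *s A (B (A v)) - B (A (A v))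
      + 2 *s (A (A v) + A (B v) + B (A v)) - (2 * \<delta>) *s A v + (2 * \<alpha>) *s v"
proof -
  have "A (A (B v)) - A (B (A v)) = 2 *s A (D v)" "A (B (A v)) - B (A (A v)) = 2 *s D (A v)"
    by (simp_all only: AB flip: endo_simps[OF A])
  moreover have "2 *s A (D v) - 2 *s D (A v) + 2 *s A (C v) - 2 *s B (A v) = (2 * \<alpha>) *s v"
    using arg_cong[OF alpha[of v], of "scale 2"] by (simp add: algebra_simps)
  ultimately have "A (A (B v)) - A (B (A v)) - (A (B (A v)) - B (A (A v)))
      + 2 *s A (C v) - 2 *s B (A v) = (2 * \<alpha>) *s v" by simp
  then show ?thesis by (simp add: C endo_simps[OF A] scale_two algebra_simps)
qed

text \<open>The sign of \<beta> arises because \<open>2 *s D\<close> is \<open>[A,B]\<close>, not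
  \<open>[B,A]\<close>.\<close>

lemma BBA: "B (B (A v)) = 2 *s B (A (B v)) - A (B (B v))
      + 2 *s (B (B v) + A (B v) + B (A v)) - (2 * \<delta>) *s B v + (2 * - \<beta>) *s v"
proof -
  have "B (A (B v)) - B (B (A v)) = 2 *s B (D v)" "A (B (B v)) - B (A (B v)) = 2 *s D (B v)"
    by (simp_all only: AB flip: endo_simps[OF B])
  moreover have "2 *s B (D v) - 2 *s D (B v) + 2 *s B (A v) - 2 *s C (B v) = (2 * \<beta>) *s v"
    using arg_cong[OF beta[of v], of "scale 2"] by (simp add: algebra_simps)
  ultimately have "B (A (B v)) - B (B (A v)) - (A (B (B v)) - B (A (B v)))
      + 2 *s B (A v) - 2 *s C (B v) = (2 * \<beta>) *s v" by simp
  then show ?thesis by (simp add: C endo_simps[OF B] scale_two algebra_simps)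
qed

lemma AAC: "A (A (C v)) = 2 *s A (C (A v)) - C (A (A v))
      + 2 *s (A (A v) + C (A v) + A (C v)) - (2 * \<delta>) *s A v + (2 * - \<alpha>) *s v"
  using AAB[of v] by (simp add: C endo_simps[OF A] scale_two algebra_simps)

text \<open>With \<open>C\<close> eliminated this is the difference of the two relations for
  \<open>A\<close> and \<open>B\<close>. The scalar \<open>- (\<alpha> + \<beta>)\<close> is the
  action of gamma, since alpha, beta and gamma add up to \<open>[\<delta>, D] = 0\<close>.\<close>

lemma CCA: "C (C (A v)) = 2 *s C (A (C v)) - A (C (C v))
      + 2 *s (C (C v) + C (A v) + A (C v)) - (2 * \<delta>) *s C v + (2 * - (\<alpha> + \<beta>)) *s v"
  using arg_cong2[OF AAB[of v] BBA[of v], of minus]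
  by (simp add: C endo_simps[OF A] endo_simps[OF B] scale_two algebra_simps)

lemma irreducible_AB:
  assumes W: "subspace W" and WA: "A ` W \<subseteq> W" and WB: "B ` W \<subseteq> W"
  shows "W = {0} \<or> W = UNIV"
proof (rule irreducible[OF W WA WB])
  have *: "A v \<in> W" "B v \<in> W" if "v \<in> W" for v using that WA WB by auto
  show "C ` W \<subseteq> W" using W * by (auto simp: C intro!: subspace_diff subspace_scale)
  show "D ` W \<subseteq> W" using W * by (auto simp: D_eq intro!: subspace_diff subspace_scale)
qed

lemma irreducible_CA:
  assumes W: "subspace W" and WC: "C ` W \<subseteq> W" and WA: "A ` W \<subseteq> W"
  shows "W = {0} \<or> W = UNIV"
proof (rule irreducible_AB[OF W WA])
  have B_eq: "B v = \<delta> *s v - A v - C v" for v by (simp add: C)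
  show "B ` W \<subseteq> W"
    using W WA WC unfolding B_eq by (auto intro!: subspace_diff subspace_scale)
qed

text \<open>Each pair yields a basis on which its first operator is triangular, so the three
  instances serve \<open>A\<close>, \<open>B\<close> and \<open>C\<close> in turn.\<close>

sublocale AB: racah_pair scale d A B \<alpha> "- \<beta>" \<delta>
  by (rule racah_pair.intro[OF vector_space_dim_alg_closed_axioms
        racah_pair_axioms.intro[OF A B AAB BBA irreducible_AB]])

sublocale BA: racah_pair scale d B A "- \<beta>" \<alpha> \<delta>
  by (rule racah_pair.intro[OF vector_space_dim_alg_closed_axioms racah_pair_axioms.intro[OF B A]])
    (use BBA AAB irreducible_AB in \<open>auto simp: add_ac\<close>)

sublocale CA: racah_pair scale d C A "- (\<alpha> + \<beta>)" "- \<alpha>" \<delta>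
  by (rule racah_pair.intro[OF vector_space_dim_alg_closed_axioms
        racah_pair_axioms.intro[OF endo_C A CCA AAC irreducible_CA]])

end

text \<open>The factor \<open>Suc d\<close> is pulled out so that it cancels from all trace
  relations.\<close>

lemma trace_theta:
  fixes scale :: "'a::field_char_0 \<Rightarrow> 'v::ab_group_add \<Rightarrow> 'v" and x :: 'a and d :: nat
  defines "p \<equiv> theta (x - of_nat d / 2)" and "m \<equiv> of_nat d * (of_nat d + 2) / 12"
    and "q \<equiv> of_nat d * (of_nat d + 2) * (3 * (of_nat d + 1)\<^sup>2 - 7) / 240"
  assumes "vector_space_dim scale d" and X: "Vector_Spaces.linear scale scale X"
    and w: "vector_space_dim.frame scale d w"
    and t: "vector_space_dim.triangular scale w (\<lambda>i. theta (x - of_nat i)) X"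
  shows "vector_space_dim.trace scale d X = of_nat (Suc d) * (p + m)"
    and "vector_space_dim.trace scale d (\<lambda>v. X (X v)) = of_nat (Suc d) * (p\<^sup>2 + (6 * p + 1) * m + q)"
proof -
  interpret vector_space_dim scale d by fact
  have p: "(2 * x - of_nat d) * (2 * x - of_nat d + 2) = 4 * p"
    by (simp add: p_def theta_def field_simps)
  have m: "of_nat d * (of_nat d + 2) = 12 * m"
    and q: "12 * m * (3 * (of_nat d + 1)\<^sup>2 - 7) = 240 * q"
    by (simp_all add: m_def q_def)
  have "trace X * 12 = of_nat (Suc d) * (p + m) * 12"
    unfolding trace_triangular[OF w X t] sum_theta mult.assoc[of 3] p m
    by (simp add: algebra_simps)
  then show "trace X = of_nat (Suc d) * (p + m)"
    by (metis mult_cancel_right zero_neq_numeral)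
  have "trace (\<lambda>v. X (X v)) * 240 = of_nat (Suc d) * (p\<^sup>2 + (6 * p + 1) * m + q) * 240"
    unfolding trace_triangular[OF w endo_compose[OF X X] triangular_square[OF X t]]
      sum_theta_square p m q
    by (simp add: algebra_simps power2_eq_square)
  then show "trace (\<lambda>v. X (X v)) = of_nat (Suc d) * (p\<^sup>2 + (6 * p + 1) * m + q)"
    by (metis mult_cancel_right zero_neq_numeral)
qed

section \<open>Matching the structure constants of \<open>R_d(a,b,c)\<close>\<close>

lemma rd_theta_eq: "rd_theta a d i = theta (a + of_nat d / 2 - of_nat i)"
  by (simp add: rd_theta_def theta_def)

text \<open>For a top eigenvector \<open>u\<close> of \<open>B\<close> and
  \<open>v = A u - theta (a + h) *s u\<close>, the right-hand side is the coefficient of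
  \<open>u\<close> in \<open>B v\<close>. Multiplying by \<open>b + h + 1\<close> brings in the
  equation for \<open>s\<close>.\<close>

lemma rd_phi_1:
  fixes a b c h :: "'a::field_char_0"
  assumes h: "h = of_nat d / 2" and s: "(b + h + 1) * s = - (theta (b + h) * theta (b + h)
      - (theta h + theta a + theta b + theta c) * theta (b + h)
      - (theta a - theta c) * (theta b - theta h))"
    and "b + h + 1 \<noteq> 0"
  shows "rd_phi a b c d (Suc 0) = s + theta (a + h) * theta (b + h - 1) - theta (a + h) * theta (b + h)"
proof -
  have d: "of_nat d = 2 * h" unfolding h by simp
  have "(b + h + 1) * rd_phi a b c d 1 = (b + h + 1) * s
      + (b + h + 1) * (theta (a + h) * theta (b + h - 1) - theta (a + h) * theta (b + h))"
    unfolding s rd_phi_def theta_def d by (simp add: algebra_simps)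
  then have "(b + h + 1) * rd_phi a b c d 1
      = (b + h + 1) * (s + theta (a + h) * theta (b + h - 1) - theta (a + h) * theta (b + h))"
    by (simp add: algebra_simps)
  then show ?thesis using assms(3) by (simp only: mult_cancel_left) simp
qed

text \<open>Writing \<open>d\<close> as \<open>2 * (d / 2)\<close> lets every occurrence fold into
  \<open>h\<close>.\<close>

lemma rd_phi_eq:
  "rd_phi a b c d i = of_nat i * (of_nat i - 2 * (of_nat d / 2) - 1)
    * (a + b + c + of_nat d / 2 - of_nat i + 2) * (a + b - c + of_nat d / 2 - of_nat i + 1)"
  by (simp add: rd_phi_def)

context racah_irr
begin

text \<open>Intended instance: \<open>I\<close> is \<open>i\<close>, the vectors \<open>e1\<close>,
  \<open>e2\<close>, \<open>e3\<close> are \<open>v_i\<close>, \<open>v_(i+1)\<close>,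
  \<open>v_(i+2)\<close>, and \<open>e0\<close> is \<open>v_(i-1)\<close> with its coefficient
  absorbed, hence 0 at \<open>i = 0\<close>. As \<open>e3\<close> is a combination of
  \<open>A (A e1)\<close>, \<open>A e1\<close> and \<open>e2\<close>, the relation
  \<open>AAB\<close> reduces \<open>B e3\<close> to known actions.\<close>

lemma B_newton_step:
  fixes a b c h I :: 'a
  defines "\<phi> \<equiv> \<lambda>k. k * (k - 2 * h - 1) * (a + b + c + h - k + 2) * (a + b - c + h - k + 1)"
    and "y \<equiv> a + h - I" and "z \<equiv> b + h - I"
  assumes \<alpha>: "\<alpha> = (theta c - theta b) * (theta a - theta h)"
    and \<delta>: "\<delta> = theta h + theta a + theta b + theta c"
    and Ae0: "A e0 = theta (y + 1) *s e0 + \<phi> I *s e1"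
    and Ae1: "A e1 = theta y *s e1 + e2" and Ae2: "A e2 = theta (y - 1) *s e2 + e3"
    and Be1: "B e1 = theta z *s e1 + e0" and Be2: "B e2 = theta (z - 1) *s e2 + \<phi> (I + 1) *s e1"
  shows "B e3 = theta (z - 2) *s e3 + \<phi> (I + 2) *s e2"
proof -
  define L where "L a0 a1 a2 a3 = a0 *s e0 + a1 *s e1 + a2 *s e2 + a3 *s e3" for a0 a1 a2 a3
  have L_add: "L a0 a1 a2 a3 + L b0 b1 b2 b3 = L (a0 + b0) (a1 + b1) (a2 + b2) (a3 + b3)"
    and L_diff: "L a0 a1 a2 a3 - L b0 b1 b2 b3 = L (a0 - b0) (a1 - b1) (a2 - b2) (a3 - b3)"
    and L_scale: "r *s L a0 a1 a2 a3 = L (r * a0) (r * a1) (r * a2) (r * a3)"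
    for a0 a1 a2 a3 b0 b1 b2 b3 r by (simp_all add: L_def algebra_simps)
  \<comment> \<open>Only combinations without \<open>e3\<close> are covered, because
    \<open>A e3\<close> is unknown.\<close>
  have AL: "A (L a0 a1 a2 0) = L (a0 * theta (y + 1)) (a0 * \<phi> I + a1 * theta y)
      (a1 + a2 * theta (y - 1)) a2" for a0 a1 a2
    unfolding L_def endo_simps[OF A] Ae0 Ae1 Ae2 by (simp add: algebra_simps)
  have e1: "e1 = L 0 1 0 0" by (simp add: L_def)
  have Be2L: "B e2 = L 0 (\<phi> (I + 1)) (theta (z - 1)) 0"
    and Ae1L: "A e1 = L 0 (theta y) 1 0" and Be1L: "B e1 = L 1 (theta z) 0 0"
    unfolding Be1 Be2 Ae1 by (simp_all add: L_def add_ac)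
  have "B (A e1) = B e2 + theta y *s B e1"
    unfolding Ae1 endo_simps[OF B] by (simp add: add_ac)
  then have BAe1: "B (A e1) = L (theta y) (\<phi> (I + 1) + theta y * theta z) (theta (z - 1)) 0"
    unfolding Be2L Be1L L_scale L_add by simp
  have "e3 = A (A e1) - theta y *s A e1 - theta (y - 1) *s e2"
    unfolding Ae1 endo_simps[OF A] Ae2 by (simp add: algebra_simps)
  then have "B e3 = B (A (A e1)) - theta y *s B (A e1) - theta (y - 1) *s B e2"
    by (simp add: endo_simps[OF B])
  also have "B (A (A e1)) = 2 *s A (B (A e1)) - A (A (B e1))
      + 2 *s (A (A e1) + A (B e1) + B (A e1)) - (2 * \<delta>) *s A e1 + (2 * \<alpha>) *s e1"
    using AAB[of e1] by (simp add: algebra_simps)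
  finally have "B e3 = 2 *s A (B (A e1)) - A (A (B e1))
      + 2 *s (A (A e1) + A (B e1) + B (A e1)) - (2 * \<delta>) *s A e1 + (2 * \<alpha>) *s e1
      - theta y *s B (A e1) - theta (y - 1) *s B e2" .
  also have "\<dots> = L
      (2 * theta y * theta (y + 1) - (theta (y + 1))\<^sup>2 + 2 * (theta (y + 1) + theta y) - (theta y)\<^sup>2)
      (2 * (theta y * \<phi> I + (\<phi> (I + 1) + theta y * theta z) * theta y)
        - (theta (y + 1) * \<phi> I + (\<phi> I + theta z * theta y) * theta y)
        + 2 * ((theta y)\<^sup>2 + \<phi> I + theta z * theta y + \<phi> (I + 1) + theta y * theta z)
        - 2 * \<delta> * theta y + 2 * \<alpha> - theta y * (\<phi> (I + 1) + theta y * theta z)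
        - theta (y - 1) * \<phi> (I + 1))
      (2 * (\<phi> (I + 1) + theta y * theta z + theta (z - 1) * theta (y - 1))
        - (\<phi> I + theta z * theta y + theta z * theta (y - 1))
        + 2 * (theta y + theta (y - 1) + theta z + theta (z - 1)) - 2 * \<delta>
        - theta y * theta (z - 1) - theta (y - 1) * theta (z - 1))
      (2 * theta (z - 1) - theta z + 2)" (is "_ = L ?c0 ?c1 ?c2 ?c3")
    unfolding BAe1 unfolding Be1L Be2L Ae1L AL unfolding e1
    by (simp add: AL L_add L_diff L_scale) (simp add: algebra_simps power2_eq_square)
  \<comment> \<open>The coefficients of \<open>e0\<close> and \<open>e1\<close> have to vanish; the
    one of \<open>e1\<close> does so because of the values of \<alpha> and \<delta>.\<close>
  also have "?c0 = 0" by (simp add: theta_def algebra_simps power2_eq_square)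
  also have "?c1 = 0" unfolding \<alpha> \<delta> \<phi>_def y_def z_def theta_def by algebra
  also have "?c2 = \<phi> (I + 2)" unfolding \<delta> \<phi>_def y_def z_def theta_def by algebra
  also have "?c3 = theta (z - 2)" by (simp add: theta_def algebra_simps)
  finally show ?thesis by (simp add: L_def add_ac)
qed

lemma Rd_isoI:
  assumes w: "frame w" "w (Suc d) = 0"
    and \<delta>: "\<delta> = rd_delta a b c d"
    and Aw: "\<And>i. A (w i) = rd_theta a d i *s w i + w (Suc i)"
    and B0: "B (w 0) = rd_theta b d 0 *s w 0"
    and Bw: "\<And>i. B (w (Suc i)) = rd_theta b d (Suc i) *s w (Suc i) + rd_phi a b c d (Suc i) *s w i"
  shows "Rd_iso scale A B C D d a b c"
proof -
  have sum_if: "(\<Sum>i\<le>d. (if i = k then f i else 0) *s w i) = (if k \<le> d then f k *s w k else 0)"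
    for k and f :: "nat \<Rightarrow> 'a"
    by (simp add: if_distrib[of "\<lambda>r. r *s _"] cong: if_cong)
  have actsA: "A (w j) = (\<Sum>i\<le>d. RdA a b c d i j *s w i)" if "j \<le> d" for j
  proof -
    have "RdA a b c d i j = (if i = j then rd_theta a d i else 0) + (if i = Suc j then 1 else 0)" for i
      by (simp add: RdA_def)
    then have "(\<Sum>i\<le>d. RdA a b c d i j *s w i)
        = rd_theta a d j *s w j + (if Suc j \<le> d then 1 *s w (Suc j) else 0)"
      unfolding sum_if[of "Suc j" "\<lambda>_. 1", symmetric] using that
      by (simp add: scale_left_distrib sum.distrib sum_if)
    \<comment> \<open>At \<open>j = d\<close> the term missing from the matrix is
      \<open>w (Suc d) = 0\<close>.\<close>
    moreover have "w (Suc j) = (if Suc j \<le> d then 1 *s w (Suc j) else 0)"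
      using that w(2) by (auto simp: not_less_eq_eq dest: le_antisym)
    ultimately show ?thesis using Aw by simp
  qed
  have actsB: "B (w j) = (\<Sum>i\<le>d. RdB a b c d i j *s w i)" if "j \<le> d" for j
  proof (cases j)
    case 0
    then have "RdB a b c d i j = (if i = 0 then rd_theta b d i else 0)" for i
      by (simp add: RdB_def)
    then show ?thesis using 0 B0 sum_if[of 0 "rd_theta b d"] by simp
  next
    case (Suc k)
    then have "RdB a b c d i j = (if i = j then rd_theta b d i else 0)
        + (if i = k then rd_phi a b c d (Suc i) else 0)" for i
      by (simp add: RdB_def)
    then have "(\<Sum>i\<le>d. RdB a b c d i j *s w i) = rd_theta b d j *s w j + rd_phi a b c d (Suc k) *s w k"
      using that Suc sum_if[of j "rd_theta b d"] sum_if[of k "\<lambda>i. rd_phi a b c d (Suc i)"]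
      by (simp add: scale_left_distrib sum.distrib)
    then show ?thesis using Bw Suc by simp
  qed
  have actsC: "C (w j) = (\<Sum>i\<le>d. RdC a b c d i j *s w i)" if "j \<le> d" for j
    using that sum_if[of j "\<lambda>_. rd_delta a b c d"]
    by (simp add: RdC_def C actsA actsB scale_left_diff_distrib sum_subtractf \<delta>)
  have comp: "X (Y (w j)) = (\<Sum>i\<le>d. (\<Sum>k\<le>d. M i k * N k j) *s w i)"
    if "endo X" "\<And>j. j \<le> d \<Longrightarrow> X (w j) = (\<Sum>i\<le>d. M i j *s w i)"
      "Y (w j) = (\<Sum>i\<le>d. N i j *s w i)" for X Y M N j
  proof -
    have "X (Y (w j)) = (\<Sum>k\<le>d. N k j *s (\<Sum>i\<le>d. M i k *s w i))"
      unfolding that(3) by (simp add: endo_simps[OF that(1)] that(2))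
    also have "\<dots> = (\<Sum>k\<le>d. \<Sum>i\<le>d. (M i k * N k j) *s w i)"
      by (simp add: scale_sum_right mult.commute)
    also have "\<dots> = (\<Sum>i\<le>d. (\<Sum>k\<le>d. M i k * N k j) *s w i)"
      by (subst sum.swap) (simp add: scale_sum_left)
    finally show ?thesis .
  qed
  have actsD: "D (w j) = (\<Sum>i\<le>d. RdD a b c d i j *s w i)" if "j \<le> d" for j
  proof -
    have "A (B (w j)) = (\<Sum>i\<le>d. (\<Sum>k\<le>d. RdA a b c d i k * RdB a b c d k j) *s w i)"
      "B (A (w j)) = (\<Sum>i\<le>d. (\<Sum>k\<le>d. RdB a b c d i k * RdA a b c d k j) *s w i)"
      using comp[OF A, of "RdA a b c d" B j "RdB a b c d"] actsA actsB
        comp[OF B, of "RdB a b c d" A j "RdA a b c d"] that by blast+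
    then show ?thesis
      by (simp add: D_eq RdD_def sum_subtractf scale_sum_right scale_left_diff_distrib
          scale_right_diff_distrib diff_divide_distrib)
  qed
  show ?thesis
    unfolding Rd_iso_def acts_by_def
  proof (intro exI[of _ w] conjI allI impI)
    show "x i = 0" if "(\<Sum>i\<le>d. x i *s w i) = 0" "i \<le> d" for x i
      by (rule frame_independent[OF w(1) that])
    show "\<exists>x. v = (\<Sum>i\<le>d. x i *s w i)" for v
      using sum_coord[OF w(1), of v] by metis
  qed (use actsA actsB actsC actsD in auto)
qed

text \<open>Tracing \<open>C = \<delta> - A - B\<close> gives \<delta>. The trace relations of the
  three pairs then involve only two unknown traces, those of \<open>AB\<close> and
  \<open>CA\<close>, which are eliminated together with \<alpha> and \<beta>.\<close>

lemma scalars_eq: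
  fixes a b c h :: 'a
  defines "h \<equiv> of_nat d / 2"
  assumes wA: "frame wA" "triangular wA (\<lambda>i. theta (a + h - of_nat i)) A"
    and wB: "frame wB" "triangular wB (\<lambda>i. theta (b + h - of_nat i)) B"
    and wC: "frame wC" "triangular wC (\<lambda>i. theta (c + h - of_nat i)) C"
  shows "\<alpha> = (theta c - theta b) * (theta a - theta h)"
    and "\<beta> = (theta a - theta c) * (theta b - theta h)"
    and "\<delta> = theta h + theta a + theta b + theta c"
proof -
  define n m q :: 'a where "n = of_nat (Suc d)" and "m = of_nat d * (of_nat d + 2) / 12"
    and "q = of_nat d * (of_nat d + 2) * (3 * (of_nat d + 1)\<^sup>2 - 7) / 240"
  define sq where "sq z = z\<^sup>2 + (6 * z + 1) * m + q" for z
  have n: "n \<noteq> 0" unfolding n_def by (rule of_nat_neq_0)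
  have m: "3 * m = theta h" by (simp add: m_def h_def theta_def field_simps)
  have tr: "trace X = n * (theta x + m)" "trace (\<lambda>v. X (X v)) = n * sq (theta x)"
    if "endo X" "frame w" "triangular w (\<lambda>i. theta (x + h - of_nat i)) X" for X w x
    using trace_theta[OF vector_space_dim_axioms that]
    by (simp_all add: n_def m_def q_def sq_def h_def)
  note trA = tr[OF A wA] and trB = tr[OF B wB] and trC = tr[OF endo_C wC]
  have "n * (theta c + m) = \<delta> * n - n * (theta a + m) - n * (theta b + m)"
    unfolding trC(1)[symmetric] trA(1)[symmetric] trB(1)[symmetric]
    unfolding C[abs_def] trace_diff trace_scale trace_id n_def ..
  then have "n * \<delta> = n * (theta a + theta b + theta c + 3 * m)"
    by (simp add: algebra_simps)
  then have \<delta>: "\<delta> = theta a + theta b + theta c + 3 * m" using n by (simp only: mult_cancel_left) simp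
  then show "\<delta> = theta h + theta a + theta b + theta c" using m by (simp add: add_ac)
  define u w where "u = trace (\<lambda>v. A (B v)) / n" and "w = trace (\<lambda>v. C (A v)) / n"
  have u: "trace (\<lambda>v. A (B v)) = n * u" "trace (\<lambda>v. B (A v)) = n * u"
    and w: "trace (\<lambda>v. C (A v)) = n * w"
    using n trace_commute[OF A B] by (simp_all add: u_def w_def)
  have cancel: "z = 0" if "n * z = 0" for z using that n by simp
  have 1: "sq (theta a) + 2 * u - \<delta> * (theta a + m) + \<alpha> = 0"
    by (rule cancel)
      (use AB.trace_relation[folded n_def, unfolded trA u] in \<open>simp add: algebra_simps\<close>)
  have 2: "sq (theta b) + 2 * u - \<delta> * (theta b + m) - \<beta> = 0"
    by (rule cancel)
      (use BA.trace_relation[folded n_def, unfolded trB u] in \<open>simp add: algebra_simps\<close>)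
  have 3: "sq (theta c) + 2 * w - \<delta> * (theta c + m) - (\<alpha> + \<beta>) = 0"
    by (rule cancel)
      (use CA.trace_relation[folded n_def, unfolded trC w] in \<open>simp add: algebra_simps\<close>)
  \<comment> \<open>The fourth equation comes from \<open>CA = \<delta> A - AA - BA\<close>.\<close>
  have "trace (\<lambda>v. C (A v)) = \<delta> * trace A - trace (\<lambda>v. A (A v)) - trace (\<lambda>v. B (A v))"
    unfolding C trace_diff trace_scale ..
  then have "n * (u + w) = n * (\<delta> * (theta a + m) - sq (theta a))"
    unfolding trA u w by (simp add: algebra_simps)
  then have 4: "u + w = \<delta> * (theta a + m) - sq (theta a)" using n by (simp only: mult_cancel_left) simp
  show "\<alpha> = (theta c - theta b) * (theta a - theta h)"
    "\<beta> = (theta a - theta c) * (theta b - theta h)"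
    using racah_parameters[OF \<delta> 1[unfolded sq_def] 2[unfolded sq_def] 3[unfolded sq_def] 4[unfolded sq_def]]
    unfolding m .
qed

lemma Rd_iso_exists: "\<exists>a b c. Rd_iso scale A B C D d a b c"
proof -
  define h :: 'a where "h = of_nat d / 2"
  obtain xa ua where
    fA: "frame (\<lambda>i. (B ^^ i) ua)" and tA: "triangular (\<lambda>i. (B ^^ i) ua) (\<lambda>i. theta (xa - of_nat i)) A"
    using AB.cyclic_frame_exists by metis
  obtain xb u s where u: "B u = theta xb *s u" and Au: "B (A u) = theta (xb - 1) *s A u + s *s u"
    and nz: "xb + 1 \<noteq> 0"
    and s: "(xb + 1) * s = - (theta xb * theta xb - \<delta> * theta xb + - \<beta>)"
    and fB: "frame (\<lambda>i. (A ^^ i) u)" and tB: "triangular (\<lambda>i. (A ^^ i) u) (\<lambda>i. theta (xb - of_nat i)) B"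
    by (rule BA.cyclic_frame_exists)
  obtain xc uc where
    fC: "frame (\<lambda>i. (A ^^ i) uc)" and tC: "triangular (\<lambda>i. (A ^^ i) uc) (\<lambda>i. theta (xc - of_nat i)) C"
    using CA.cyclic_frame_exists by metis
  \<comment> \<open>The ladders start at \<open>theta xa\<close> and so on, whereas those of
    \<open>R_d(a,b,c)\<close> start at \<open>theta (a + d / 2)\<close>.\<close>
  define a b c where "a = xa - h" and "b = xb - h" and "c = xc - h"
  have x: "xa = a + h" "xb = b + h" "xc = c + h" by (simp_all add: a_def b_def c_def)
  note eqs = scalars_eq[OF fA tA[unfolded x h_def] fB tB[unfolded x h_def] fC tC[unfolded x h_def],
      folded h_def]
  have \<theta>: "rd_theta z d i = theta (z + h - of_nat i)" for z i by (simp add: rd_theta_eq h_def)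
  have \<phi>: "rd_phi a b c d i = of_nat i * (of_nat i - 2 * h - 1)
      * (a + b + c + h - of_nat i + 2) * (a + b - c + h - of_nat i + 1)" for i
    unfolding h_def by (rule rd_phi_eq)
  define w where "w i = newton (rd_theta a d) A i u" for i
  \<comment> \<open>This is the vector \<open>e0\<close> of \<open>B_newton_step\<close>, with
    default 0 at index 0.\<close>
  define g where "g i = (case i of 0 \<Rightarrow> 0 | Suc k \<Rightarrow> rd_phi a b c d i *s w k)" for i
  have Aw: "A (w i) = rd_theta a d i *s w i + w (Suc i)" for i by (simp add: w_def)
  have Ag: "A (g i) = theta (a + h - of_nat i + 1) *s g i + rd_phi a b c d i *s w i" for i
  proof (cases i)
    case 0
    then show ?thesis by (simp add: g_def endo_simps[OF A] rd_phi_def)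
  next
    case (Suc k)
    have e: "a + h - of_nat i + 1 = a + h - of_nat k" by (simp add: Suc)
    show ?thesis
      unfolding e by (simp add: Suc g_def endo_simps[OF A] Aw \<theta> scale_right_distrib mult.commute)
  qed
  \<comment> \<open>The step consumes two consecutive indices: index 0 is the eigenvector equation
    for \<open>u\<close>, and index 1 comes from \<open>Au\<close>.\<close>
  have Bw: "B (w i) = rd_theta b d i *s w i + g i
      \<and> B (w (Suc i)) = rd_theta b d (Suc i) *s w (Suc i) + g (Suc i)" for i
  proof (induction i)
    case 0
    have \<phi>1: "rd_phi a b c d (Suc 0) = s + theta (a + h) * theta (b + h - 1) - theta (a + h) * theta (b + h)"
      by (rule rd_phi_1[OF h_def _ nz[unfolded x]])
        (use s in \<open>simp add: x eqs(2,3)\<close>)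
    show ?case
      using u Au by (simp add: w_def g_def \<theta> \<phi>1 x endo_simps[OF B] algebra_simps)
  next
    case (Suc i)
    have "B (w (Suc (Suc i))) = theta (b + h - of_nat i - 2) *s w (Suc (Suc i))
        + rd_phi a b c d (Suc (Suc i)) *s w (Suc i)"
      unfolding \<phi>
      using B_newton_step[OF eqs(1,3), of "g i" "of_nat i" "w i" "w (Suc i)" "w (Suc (Suc i))"]
        Ag[of i] Aw[of i] Aw[of "Suc i"] Suc
      by (simp add: \<theta> \<phi> g_def algebra_simps)
    then show ?case using Suc by (simp add: g_def \<theta> algebra_simps)
  qed
  have "Rd_iso scale A B C D d a b c"
  proof (rule Rd_isoI)
    show "frame w" unfolding w_def[abs_def] by (rule frame_newton[OF A fB])
    \<comment> \<open>The nodes are the diagonal of \<open>A\<close> on its own triangular basis, so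
      the product of all \<open>d + 1\<close> factors kills every vector, in particular
      \<open>u\<close>.\<close>
    have "rd_theta a d = (\<lambda>i. theta (xa - of_nat i))" by (auto simp: \<theta> x)
    then show "w (Suc d) = 0" unfolding w_def using newton_frame_zero[OF A tA fA] by simp
    show "\<delta> = rd_delta a b c d" by (simp add: eqs(3) rd_delta_def theta_def h_def)
    show "B (w 0) = rd_theta b d 0 *s w 0" using Bw[of 0] by (simp add: g_def)
  qed (use Aw Bw in \<open>auto simp: g_def\<close>)
  then show ?thesis by blast
qed

end

section \<open>Schur's lemma and the reduction to scalar actions\<close>

lemma (in vector_space_dim_alg_closed) commuting_endo_scalar:
  assumes Z: "endo Z" and comm: "\<And>X. X \<in> S \<Longrightarrow> endo X \<and> commutes_with Z X"
    and irr: "\<And>W. subspace W \<Longrightarrow> (\<forall>X\<in>S. X ` W \<subseteq> W) \<Longrightarrow> W = {0} \<or> W = UNIV"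
  shows "\<exists>r. \<forall>v. Z v = r *s v"
proof -
  obtain r u where u: "u \<noteq> 0" "Z u = r *s u" using eigen_exists[OF Z] unfolding eigen_def by blast
  \<comment> \<open>An eigenspace of \<open>Z\<close> is stable under everything that commutes with
    \<open>Z\<close>.\<close>
  have "subspace {v. Z v = r *s v}"
    unfolding subspace_def by (simp add: endo_simps[OF Z] scale_right_distrib mult.commute)
  moreover have "X ` {v. Z v = r *s v} \<subseteq> {v. Z v = r *s v}" if "X \<in> S" for X
    using comm[OF that] by (auto simp: commutes_with_def endo_simps)
  ultimately have "{v. Z v = r *s v} = UNIV" using irr u by blast
  then show ?thesis by blast
qed

theorem theorem6p3:
  fixes sc :: "'a::{alg_closed_field, field_char_0} \<Rightarrow> 'v::ab_group_add \<Rightarrow> 'v"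
    and A B C D :: "'v \<Rightarrow> 'v"
    and d :: nat
  assumes "racah_module sc A B C D"
    and "vector_space.dim sc (UNIV :: 'v set) = d + 1"
    and "racah_irreducible sc A B C D"
  shows "\<exists>a b c :: 'a. Rd_iso sc A B C D d a b c"
proof -
  note mod = assms(1)[unfolded racah_module_def]
  interpret vector_space sc using mod by blast
  interpret vector_space_dim_alg_closed sc d by unfold_locales (use assms(2) in simp)
  have endos: "endo A" "endo B" "endo C" "endo D" using mod by blast+
  have AB: "A (B v) - B (A v) = sc 2 (D v)" and BC: "B (C v) - C (B v) = sc 2 (D v)"
    and CA: "C (A v) - A (C v) = sc 2 (D v)" for v
    using mod by (auto simp: op_comm_def)
  have irr: "W = {0} \<or> W = UNIV" if "subspace W" "\<forall>X\<in>{A, B, C, D}. X ` W \<subseteq> W" for W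
    using assms(3) that unfolding racah_irreducible_def by blast
  have scalar: "\<exists>r. \<forall>v. Z v = sc r v" if "endo Z" "\<forall>X\<in>{A, B, C, D}. commutes_with Z X" for Z
    by (rule commuting_endo_scalar[OF that(1), of "{A, B, C, D}"]) (use that(2) endos irr in auto)
  have "endo (racah_alpha A B C D)" "endo (racah_beta A B C D)"
    by (rule endoI; simp add: racah_alpha_def racah_beta_def op_comm_def endo_simps[OF endos(1)]
        endo_simps[OF endos(2)] endo_simps[OF endos(3)] endo_simps[OF endos(4)] algebra_simps)+
  then obtain \<alpha> \<beta> where \<alpha>: "\<And>v. racah_alpha A B C D v = sc \<alpha> v"
    and \<beta>: "\<And>v. racah_beta A B C D v = sc \<beta> v"
    using scalar mod by (metis insertCI)
  \<comment> \<open>The equal commutators cancel in pairs, so the sum commutes with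
    \<open>A\<close>, \<open>B\<close> and \<open>C\<close>, and hence with \<open>D\<close>, which
    is half of \<open>[A,B]\<close>.\<close>
  define \<Delta> where "\<Delta> v = A v + B v + C v" for v
  have comm: "\<Delta> (A v) = A (\<Delta> v)" "\<Delta> (B v) = B (\<Delta> v)" "\<Delta> (C v) = C (\<Delta> v)" for v
    using AB[of v] BC[of v] CA[of v]
    by (simp_all add: \<Delta>_def endo_simps[OF endos(1)] endo_simps[OF endos(2)] endo_simps[OF endos(3)]
        algebra_simps)
  have endo_\<Delta>: "endo \<Delta>"
    by (rule endoI) (simp_all add: \<Delta>_def endo_simps[OF endos(1)] endo_simps[OF endos(2)]
        endo_simps[OF endos(3)] algebra_simps)
  have D: "D v = sc (1 / 2) (A (B v) - B (A v))" for v unfolding AB by simp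
  have "\<Delta> (D v) = D (\<Delta> v)" for v
    unfolding D by (simp only: endo_simps[OF endo_\<Delta>] comm)
  then obtain \<delta> where \<delta>: "\<And>v. \<Delta> v = sc \<delta> v"
    using scalar[OF endo_\<Delta>] comm by (auto simp: commutes_with_def)
  interpret racah_irr sc d A B C D \<alpha> \<beta> \<delta>
  proof (rule racah_irr.intro[OF vector_space_dim_alg_closed_axioms racah_irr_axioms.intro])
    show "C v = sc \<delta> v - A v - B v" for v unfolding \<delta>[symmetric] by (simp add: \<Delta>_def)
    show "A (D v) - D (A v) + A (C v) - B (A v) = sc \<alpha> v"
      "B (D v) - D (B v) + B (A v) - C (B v) = sc \<beta> v" for v
      using \<alpha>[of v] \<beta>[of v] by (simp_all add: racah_alpha_def racah_beta_def op_comm_def)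
  qed (use endos AB irr in auto)
  show ?thesis by (rule Rd_iso_exists)
qed

end
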